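(* Let $R$ be a unital $*$-ring and let $a,w\in R$. The following conditions are equivalent: (i) $a$ is $w$-core invertible. (ii) There exists a unique projection $p\in R$ such that $pa=0$ and $u=p+aw\in R^{-1}$. (iii) There exists a projection $p\in R$ such that $pa=0$ and $u=p+aw\in R^{-1}$. In this case, the $w$-core inverse of $a$ equals $u^{-1}(1-p)$.
   Context: A unital $*$-ring is an associative ring $R$ with identity $1$ and a map $*$ satisfying $(x^* )^*=x$, $(xy)^*=y^*x^*$ and $(x+y)^*=x^*+y^*$ for all $x,y\in R$. $R^{-1}$ is the group of invertible elements of $R$. A projection is an element $p\in R$ with $p=p^2=p^*$. For $a,w\in R$, $a$ is $w$-core invertible if there exists $x\in R$ with $awx^2=x$, $xawa=a$ and $(awx)^*=awx$. Such an $x$ is unique if it exists and is called the $w$-core inverse of $a$. *)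

theory Defs
  imports "HOL-Algebra.Ring"
begin

text \<open>The locale \<^locale>\<open>ring\<close> is that of associative rings with identity; neither commutativity
  nor \<open>\<one> \<noteq> \<zero>\<close> is assumed.\<close>

locale star_ring = ring R for R (structure) +
  fixes star :: "'a \<Rightarrow> 'a"
  assumes star_closed [simp, intro]: "x \<in> carrier R \<Longrightarrow> star x \<in> carrier R"
    and star_star [simp]: "x \<in> carrier R \<Longrightarrow> star (star x) = x"
    and star_mult: "\<lbrakk>x \<in> carrier R; y \<in> carrier R\<rbrakk> \<Longrightarrow> star (x \<otimes> y) = star y \<otimes> star x"
    and star_add: "\<lbrakk>x \<in> carrier R; y \<in> carrier R\<rbrakk> \<Longrightarrow> star (x \<oplus> y) = star x \<oplus> star y"

definition projection :: "('a, 'b) ring_scheme \<Rightarrow> ('a \<Rightarrow> 'a) \<Rightarrow> 'a \<Rightarrow> bool" where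
  "projection R star p \<longleftrightarrow> p \<in> carrier R \<and> p = p \<otimes>\<^bsub>R\<^esub> p \<and> p = star p"

definition is_w_core_inverse ::
    "('a, 'b) ring_scheme \<Rightarrow> ('a \<Rightarrow> 'a) \<Rightarrow> 'a \<Rightarrow> 'a \<Rightarrow> 'a \<Rightarrow> bool" where
  "is_w_core_inverse R star w a x \<longleftrightarrow>
     x \<in> carrier R \<and>
     a \<otimes>\<^bsub>R\<^esub> w \<otimes>\<^bsub>R\<^esub> (x [^]\<^bsub>R\<^esub> (2::nat)) = x \<and>
     x \<otimes>\<^bsub>R\<^esub> a \<otimes>\<^bsub>R\<^esub> w \<otimes>\<^bsub>R\<^esub> a = a \<and>
     star (a \<otimes>\<^bsub>R\<^esub> w \<otimes>\<^bsub>R\<^esub> x) = a \<otimes>\<^bsub>R\<^esub> w \<otimes>\<^bsub>R\<^esub> x"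

definition w_core_invertible ::
    "('a, 'b) ring_scheme \<Rightarrow> ('a \<Rightarrow> 'a) \<Rightarrow> 'a \<Rightarrow> 'a \<Rightarrow> bool" where
  "w_core_invertible R star w a \<longleftrightarrow> (\<exists>x. is_w_core_inverse R star w a x)"

text \<open>Meaningful only if \<open>a\<close> is \<open>w\<close>-core invertible; the description is then justified by
  the uniqueness lemma below.\<close>

definition w_core_inverse ::
    "('a, 'b) ring_scheme \<Rightarrow> ('a \<Rightarrow> 'a) \<Rightarrow> 'a \<Rightarrow> 'a \<Rightarrow> 'a" where
  "w_core_inverse R star w a = (THE x. is_w_core_inverse R star w a x)"

context star_ring
begin

lemma w_core_inverse_aux:
  assumes [simp]: "a \<in> carrier R" "w \<in> carrier R"
    and x: "is_w_core_inverse R star w a x" and y: "is_w_core_inverse R star w a y"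
  shows "a \<otimes> w \<otimes> x \<otimes> (a \<otimes> w \<otimes> y) = a \<otimes> w \<otimes> y"
    and "x \<otimes> (a \<otimes> w \<otimes> y) = y"
proof -
  have [simp]: "x \<in> carrier R" "y \<in> carrier R"
    using x y by (auto simp: is_w_core_inverse_def)
  have x1: "a \<otimes> w \<otimes> (x \<otimes> x) = x" and x2: "x \<otimes> a \<otimes> w \<otimes> a = a"
    and y1: "a \<otimes> w \<otimes> (y \<otimes> y) = y"
    using x y by (simp_all add: is_w_core_inverse_def numeral_2_eq_2 m_assoc)
  have "a \<otimes> w \<otimes> x \<otimes> a = a \<otimes> w \<otimes> x \<otimes> (x \<otimes> a \<otimes> w \<otimes> a)"
    by (simp only: x2)
  also have "\<dots> = a \<otimes> w \<otimes> (x \<otimes> x) \<otimes> a \<otimes> w \<otimes> a"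
    by (simp add: m_assoc)
  also have "\<dots> = a"
    by (simp only: x1 x2)
  finally have ax: "a \<otimes> w \<otimes> x \<otimes> a = a" .
  have "a \<otimes> w \<otimes> x \<otimes> (a \<otimes> w \<otimes> y) = a \<otimes> w \<otimes> x \<otimes> a \<otimes> w \<otimes> y"
    by (simp add: m_assoc)
  then show "a \<otimes> w \<otimes> x \<otimes> (a \<otimes> w \<otimes> y) = a \<otimes> w \<otimes> y"
    by (simp only: ax)
  have "x \<otimes> (a \<otimes> w \<otimes> y) = x \<otimes> (a \<otimes> w \<otimes> (a \<otimes> w \<otimes> (y \<otimes> y)))"
    by (simp only: y1)
  also have "\<dots> = x \<otimes> a \<otimes> w \<otimes> a \<otimes> w \<otimes> (y \<otimes> y)"
    by (simp add: m_assoc)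
  also have "\<dots> = y"
    by (simp only: x2 y1)
  finally show "x \<otimes> (a \<otimes> w \<otimes> y) = y" .
qed

lemma w_core_inverse_unique:
  assumes aw [simp]: "a \<in> carrier R" "w \<in> carrier R"
    and x: "is_w_core_inverse R star w a x" and y: "is_w_core_inverse R star w a y"
  shows "x = y"
proof -
  have [simp]: "x \<in> carrier R" "y \<in> carrier R"
    and sx: "star (a \<otimes> w \<otimes> x) = a \<otimes> w \<otimes> x" and sy: "star (a \<otimes> w \<otimes> y) = a \<otimes> w \<otimes> y"
    using x y by (auto simp: is_w_core_inverse_def)
  have "a \<otimes> w \<otimes> y = star (a \<otimes> w \<otimes> x \<otimes> (a \<otimes> w \<otimes> y))"
    by (simp only: w_core_inverse_aux(1)[OF aw x y] sy)
  also have "\<dots> = star (a \<otimes> w \<otimes> y) \<otimes> star (a \<otimes> w \<otimes> x)"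
    by (rule star_mult) simp_all
  also have "\<dots> = a \<otimes> w \<otimes> x"
    by (simp only: sx sy w_core_inverse_aux(1)[OF aw y x])
  finally have eq: "a \<otimes> w \<otimes> y = a \<otimes> w \<otimes> x" .
  have "x = x \<otimes> (a \<otimes> w \<otimes> x)"
    by (simp only: w_core_inverse_aux(2)[OF aw x x])
  also have "\<dots> = y"
    by (simp only: eq[symmetric] w_core_inverse_aux(2)[OF aw x y])
  finally show ?thesis .
qed

lemma w_core_inverse_eq:
  assumes "a \<in> carrier R" "w \<in> carrier R" "is_w_core_inverse R star w a x"
  shows "w_core_inverse R star w a = x"
  unfolding w_core_inverse_def
  using assms w_core_inverse_unique by (blast intro: the_equality)

end

end

theory Submission
  imports Defs
begin

text \<open>Put \<open>b = aw\<close>. If \<open>x\<close> is the \<open>w\<close>-core inverse of \<open>a\<close>, then \<open>bxb = b\<close>, \<open>xbx = x\<close> and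
  \<open>xbb = b\<close>, so \<open>p = 1 - bx\<close> is a projection and \<open>x + 1 - xb\<close> is the inverse of \<open>p + b\<close>.
  Conversely, \<open>pa = 0\<close> gives \<open>pu = p\<close>, hence \<open>p = pu\<^sup>-\<^sup>1\<close>, and for \<open>x = u\<^sup>-\<^sup>1(1 - p)\<close> it follows
  that \<open>bx = (u - p)x = 1 - p\<close>. The last identity recovers \<open>p\<close> from \<open>x\<close>, so uniqueness of \<open>p\<close>
  reduces to uniqueness of the \<open>w\<close>-core inverse.\<close>

context star_ring
begin

lemma star_one [simp]: "star \<one> = \<one>"
proof -
  \<comment> \<open>The right-hand side is evaluated in two ways: \<open>star_mult\<close> gives
    \<open>star \<one>\<close>, the unit law and \<open>star_star\<close> give
    \<open>\<one>\<close>.\<close>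
  have "star \<one> = star (star \<one> \<otimes> \<one>)"
    by (subst star_mult) simp_all
  then show ?thesis
    by simp
qed

lemma star_zero [simp]: "star \<zero> = \<zero>"
  using star_add[of \<zero> \<zero>] by (metis add.r_cancel_one' star_closed l_zero zero_closed)

lemma star_minus:
  assumes "x \<in> carrier R" "y \<in> carrier R"
  shows "star (x \<ominus> y) = star x \<ominus> star y"
proof -
  have "star (\<ominus> y) \<oplus> star y = \<zero>"
    using assms star_add[of "\<ominus> y" y] by (simp add: l_neg)
  then have "star (\<ominus> y) = \<ominus> star y"
    using assms by (simp add: minus_equality)
  then show ?thesis
    using assms by (simp add: minus_eq star_add)
qed

text \<open>Prepares the hypotheses of \<open>unit_of_core_inverse\<close> for b = aw. The first
  identity comes from replacing the last a by xawa and collapsing awxx to x, the second from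
  \<open>w_core_inverse_aux\<close> with both inverses equal to x.\<close>

lemma w_core_inverse_products:
  assumes [simp]: "a \<in> carrier R" "w \<in> carrier R" and x: "is_w_core_inverse R star w a x"
  shows "a \<otimes> w \<otimes> x \<otimes> a = a" "x \<otimes> (a \<otimes> w) \<otimes> x = x" "x \<otimes> (a \<otimes> w) \<otimes> (a \<otimes> w) = a \<otimes> w"
    "a \<otimes> w \<otimes> x \<otimes> x = x"
proof -
  have [simp]: "x \<in> carrier R"
    using x by (simp add: is_w_core_inverse_def)
  have x1: "a \<otimes> w \<otimes> (x \<otimes> x) = x" and x2: "x \<otimes> a \<otimes> w \<otimes> a = a"
    using x by (simp_all add: is_w_core_inverse_def numeral_2_eq_2 m_assoc)
  show "x \<otimes> (a \<otimes> w) \<otimes> x = x"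
    using w_core_inverse_aux(2)[OF assms(1,2) x x] by (simp add: m_assoc)
  show "a \<otimes> w \<otimes> x \<otimes> x = x"
    using x1 by (simp add: m_assoc)
  show "x \<otimes> (a \<otimes> w) \<otimes> (a \<otimes> w) = a \<otimes> w"
    using arg_cong[OF x2, of "\<lambda>y. y \<otimes> w"] by (simp add: m_assoc)
  have "a \<otimes> w \<otimes> x \<otimes> a = a \<otimes> w \<otimes> x \<otimes> (x \<otimes> a \<otimes> w \<otimes> a)"
    by (simp only: x2)
  also have "\<dots> = a \<otimes> w \<otimes> (x \<otimes> x) \<otimes> a \<otimes> w \<otimes> a"
    by (simp add: m_assoc)
  also have "\<dots> = a"
    by (simp only: x1 x2)
  finally show "a \<otimes> w \<otimes> x \<otimes> a = a" .
qed

text \<open>The idempotents e = bx and f = xb satisfy ef = f and fe = e, so (1 - e)(1 - f) = 1 - e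
  and (1 - f)(1 - e) = 1 - f. In both products of u = 1 - e + b and v = x + 1 - f the mixed terms
  vanish.\<close>

lemma unit_of_core_inverse:
  assumes [simp]: "b \<in> carrier R" "x \<in> carrier R"
    and bxb: "b \<otimes> x \<otimes> b = b" and xbx: "x \<otimes> b \<otimes> x = x"
    and xbb: "x \<otimes> b \<otimes> b = b" and bxx: "b \<otimes> x \<otimes> x = x"
  shows "\<one> \<ominus> b \<otimes> x \<oplus> b \<in> Units R"
proof -
  define u v where "u = \<one> \<ominus> b \<otimes> x \<oplus> b" and "v = x \<oplus> (\<one> \<ominus> x \<otimes> b)"
  have [simp]: "u \<in> carrier R" "v \<in> carrier R"
    by (simp_all add: u_def v_def)
  have bxxb: "b \<otimes> x \<otimes> (x \<otimes> b) = x \<otimes> b" and xbbx: "x \<otimes> b \<otimes> (b \<otimes> x) = b \<otimes> x"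
    using bxx xbb by (simp_all flip: m_assoc)
  have xbx': "x \<otimes> (b \<otimes> x) = x" and bxb': "b \<otimes> (x \<otimes> b) = b"
    using xbx bxb by (simp_all add: m_assoc)
  \<comment> \<open>The three groups are (1 - bx)x, (1 - bx)(1 - xb) and bv; they reduce to 0, 1 -
    bx and bx.\<close>
  have "u \<otimes> v = (x \<ominus> b \<otimes> x \<otimes> x) \<oplus> (\<one> \<ominus> x \<otimes> b \<ominus> (b \<otimes> x \<ominus> b \<otimes> x \<otimes> (x \<otimes> b)))
      \<oplus> (b \<otimes> x \<oplus> (b \<ominus> b \<otimes> (x \<otimes> b)))"
    unfolding u_def v_def by (simp add: ring_simprules)
  also have "\<dots> = \<one>"
    unfolding bxx bxxb bxb' using assms(1,2) by algebra
  finally have uv: "u \<otimes> v = \<one>" .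
  \<comment> \<open>Here the groups are xu, (1 - xb)(1 - bx) and (1 - xb)b, which reduce to xb, 1 -
    xb and 0.\<close>
  have "v \<otimes> u = (x \<ominus> x \<otimes> (b \<otimes> x) \<oplus> x \<otimes> b) \<oplus> (\<one> \<ominus> b \<otimes> x \<ominus> (x \<otimes> b \<ominus> x \<otimes> b \<otimes> (b \<otimes> x)))
      \<oplus> (b \<ominus> x \<otimes> b \<otimes> b)"
    unfolding u_def v_def by (simp add: ring_simprules)
  also have "\<dots> = \<one>"
    unfolding xbx' xbbx xbb using assms(1,2) by algebra
  finally have "v \<otimes> u = \<one>" .
  with uv have "u \<in> Units R"
    unfolding Units_def by auto
  then show ?thesis
    by (simp only: u_def)
qed

lemma projection_of_w_core_inverse:
  assumes [simp]: "a \<in> carrier R" "w \<in> carrier R" and x: "is_w_core_inverse R star w a x"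
  defines "p \<equiv> \<one> \<ominus> a \<otimes> w \<otimes> x"
  shows "projection R star p" "p \<otimes> a = \<zero>" "p \<oplus> a \<otimes> w \<in> Units R"
proof -
  have [simp]: "x \<in> carrier R" and sx: "star (a \<otimes> w \<otimes> x) = a \<otimes> w \<otimes> x"
    using x by (simp_all add: is_w_core_inverse_def)
  have carr: "a \<in> carrier R" "w \<in> carrier R" "x \<in> carrier R"
    by simp_all
  note prods = w_core_inverse_products[OF assms(1,2) x]
  have bxb: "a \<otimes> w \<otimes> x \<otimes> (a \<otimes> w) = a \<otimes> w"
    using prods(1) by (simp flip: m_assoc)
  show "p \<oplus> a \<otimes> w \<in> Units R"
    unfolding p_def using bxb prods(2-4) by (intro unit_of_core_inverse) simp_all
  have "p \<otimes> a = a \<ominus> a \<otimes> w \<otimes> x \<otimes> a"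
    unfolding p_def using carr by algebra
  then show "p \<otimes> a = \<zero>"
    by (simp only: prods(1)) (simp add: minus_eq r_neg)
  \<comment> \<open>Idempotency of awx follows from bxb = b; the symmetry of p is that of
    awx.\<close>
  have "p \<otimes> p = p \<ominus> (a \<otimes> w \<otimes> x \<ominus> a \<otimes> w \<otimes> x \<otimes> (a \<otimes> w) \<otimes> x)"
    unfolding p_def by (simp add: ring_simprules)
  also have "\<dots> = p"
    unfolding bxb p_def using carr by algebra
  finally show "projection R star p"
    by (simp add: projection_def) (simp add: p_def star_minus sx)
qed

lemma w_core_inverse_of_projection:
  assumes [simp]: "a \<in> carrier R" "w \<in> carrier R"
    and p: "projection R star p" and pa: "p \<otimes> a = \<zero>" and u: "p \<oplus> a \<otimes> w \<in> Units R"
  defines "x \<equiv> inv (p \<oplus> a \<otimes> w) \<otimes> (\<one> \<ominus> p)"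
  shows "a \<otimes> w \<otimes> x = \<one> \<ominus> p" "is_w_core_inverse R star w a x"
proof -
  define u v where "u = p \<oplus> a \<otimes> w" and "v = inv u"
  have [simp]: "p \<in> carrier R" and pp: "p \<otimes> p = p" and sp: "star p = p"
    using p by (simp_all add: projection_def)
  have [simp]: "u \<in> carrier R" "v \<in> carrier R" and uv: "u \<otimes> v = \<one>" and vu: "v \<otimes> u = \<one>"
    using u by (simp_all add: u_def v_def)
  have x_eq: "x = v \<otimes> (\<one> \<ominus> p)"
    by (simp add: x_def v_def u_def)
  have [simp]: "x \<in> carrier R"
    by (simp add: x_eq)
  have carr: "a \<in> carrier R" "w \<in> carrier R" "p \<in> carrier R" "v \<in> carrier R" "x \<in> carrier R"
    by simp_all
  have paw: "p \<otimes> (a \<otimes> w) = \<zero>"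
    using pa by (simp flip: m_assoc)
  have pu: "p \<otimes> u = p"
    by (simp add: u_def r_distr pp paw)
  have pv: "p \<otimes> v = p"
  proof -
    have "p \<otimes> v = p \<otimes> u \<otimes> v"
      by (simp only: pu)
    also have "\<dots> = p"
      by (simp add: m_assoc uv)
    finally show ?thesis .
  qed
  have p1p: "p \<otimes> (\<one> \<ominus> p) = \<zero>"
    by (simp add: minus_eq r_distr r_minus pp r_neg)
  have px: "p \<otimes> x = \<zero>"
    by (simp add: x_eq pv p1p flip: m_assoc)
  have ux: "u \<otimes> x = \<one> \<ominus> p"
    by (simp add: x_eq uv flip: m_assoc)
  \<comment> \<open>Of the two summands of ux, the first is zero, since px = pv(1 - p) = p(1 -
    p).\<close>
  have "u \<otimes> x = p \<otimes> x \<oplus> a \<otimes> w \<otimes> x"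
    by (simp add: u_def l_distr)
  then show awx: "a \<otimes> w \<otimes> x = \<one> \<ominus> p"
    by (simp add: px ux)
  have "a \<otimes> w \<otimes> (x \<otimes> x) = (\<one> \<ominus> p) \<otimes> x"
    by (simp add: awx flip: m_assoc)
  also have "\<dots> = x \<ominus> p \<otimes> x"
    using carr by algebra
  also have "\<dots> = x"
    by (simp add: px minus_eq)
  finally have awxx: "a \<otimes> w \<otimes> (x \<otimes> x) = x" .
  have ua: "u \<otimes> a = a \<otimes> w \<otimes> a"
    by (simp add: u_def l_distr pa)
  \<comment> \<open>The condition pa = 0 acts twice: it removes the factor 1 - p in front of awa,
    and it turns awa into ua, where v cancels u.\<close>
  have "x \<otimes> a \<otimes> w \<otimes> a = v \<otimes> (a \<otimes> w \<otimes> a \<ominus> p \<otimes> a \<otimes> w \<otimes> a)"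
    unfolding x_eq using carr by algebra
  also have "\<dots> = v \<otimes> (u \<otimes> a)"
    by (simp add: pa ua minus_eq)
  also have "\<dots> = a"
    by (simp add: vu flip: m_assoc)
  finally have "x \<otimes> a \<otimes> w \<otimes> a = a" .
  with awxx show "is_w_core_inverse R star w a x"
    by (simp add: is_w_core_inverse_def awx star_minus sp numeral_2_eq_2)
qed

lemma projection_unique:
  assumes aw: "a \<in> carrier R" "w \<in> carrier R"
    and p: "projection R star p" "p \<otimes> a = \<zero>" "p \<oplus> a \<otimes> w \<in> Units R"
    and q: "projection R star q" "q \<otimes> a = \<zero>" "q \<oplus> a \<otimes> w \<in> Units R"
  shows "p = q"
proof -
  have [simp]: "p \<in> carrier R" "q \<in> carrier R"
    using p(1) q(1) by (simp_all add: projection_def)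
  \<comment> \<open>Both p and q yield a w-core inverse x of a; these coincide, and each complement
    equals awx.\<close>
  have "\<one> \<ominus> p = \<one> \<ominus> q"
    using w_core_inverse_of_projection[OF aw p] w_core_inverse_of_projection[OF aw q]
      w_core_inverse_unique[OF aw] by metis
  then have "\<one> \<ominus> (\<one> \<ominus> p) = \<one> \<ominus> (\<one> \<ominus> q)"
    by (simp only:)
  moreover have "\<one> \<ominus> (\<one> \<ominus> p) = p" "\<one> \<ominus> (\<one> \<ominus> q) = q"
    using \<open>p \<in> carrier R\<close> \<open>q \<in> carrier R\<close> by algebra+
  ultimately show ?thesis
    by simp
qed

end

theorem theorem3p1:
  fixes R :: "('a, 'b) ring_scheme" (structure)
    and star :: "'a \<Rightarrow> 'a" and a w :: 'a
  assumes "star_ring R star" and "a \<in> carrier R" and "w \<in> carrier R"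
  shows "(w_core_invertible R star w a \<longleftrightarrow>
            (\<exists>!p. projection R star p \<and> p \<otimes> a = \<zero> \<and> p \<oplus> a \<otimes> w \<in> Units R))
       \<and> ((\<exists>!p. projection R star p \<and> p \<otimes> a = \<zero> \<and> p \<oplus> a \<otimes> w \<in> Units R) \<longleftrightarrow>
            (\<exists>p. projection R star p \<and> p \<otimes> a = \<zero> \<and> p \<oplus> a \<otimes> w \<in> Units R))
       \<and> (\<forall>p. projection R star p \<and> p \<otimes> a = \<zero> \<and> p \<oplus> a \<otimes> w \<in> Units R \<longrightarrow>
            w_core_inverse R star w a = inv (p \<oplus> a \<otimes> w) \<otimes> (\<one> \<ominus> p))"
proof -
  interpret star_ring R star
    by (rule assms(1))
  let ?P = "\<lambda>p. projection R star p \<and> p \<otimes> a = \<zero> \<and> p \<oplus> a \<otimes> w \<in> Units R"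
  note aw = assms(2,3)
  \<comment> \<open>From left to right the witness is 1 - awx, from right to left it is the inverse
    of p + aw times 1 - p.\<close>
  have inv: "w_core_invertible R star w a \<longleftrightarrow> (\<exists>p. ?P p)"
    unfolding w_core_invertible_def
    using projection_of_w_core_inverse[OF aw] w_core_inverse_of_projection(2)[OF aw] by blast
  have ex1: "(\<exists>!p. ?P p) \<longleftrightarrow> (\<exists>p. ?P p)"
    using projection_unique[OF aw] by blast
  have "\<forall>p. ?P p \<longrightarrow> w_core_inverse R star w a = inv (p \<oplus> a \<otimes> w) \<otimes> (\<one> \<ominus> p)"
    using w_core_inverse_of_projection(2)[OF aw] w_core_inverse_eq[OF aw] by blast
  with inv ex1 show ?thesis
    by simp
qed

end
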